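(* Let $G$ be a $K_4$-minor-free graph and let $x,y$ be distinct vertices of $G$. Then $G$ is $(2,2)$-AT extendable with respect to $(x,y)$. Moreover, if $\{x,y\}$ is not connected by a chain of diamonds, then $G$ is $(2,1)$-AT extendable with respect to $(x,y)$.
   Context: All graphs are finite and simple. For an orientation $D$ of a graph $G$, an Eulerian sub-digraph of $D$ is a spanning sub-digraph $F$ of $D$ with $d^+_F(v)=d^-_F(v)$ for every vertex $v$. Let $\mathrm{diff}(D)$ be the number of Eulerian sub-digraphs of $D$ with an even number of arcs minus the number with an odd number of arcs; $D$ is an AT-orientation if $\mathrm{diff}(D)\neq 0$. For $f:V(G)\to\mathbb{N}$, $G$ is $f$-AT if $G$ has an AT-orientation $D$ with $d^+_D(v)\le f(v)-1$ for every vertex $v$. $G$ is $f$-choosable if for every assignment of lists $L(v)\subseteq\mathbb{N}$ with $|L(v)|\ge f(v)$ there is a proper coloring $\varphi$ with $\varphi(v)\in L(v)$ for all $v$. Given distinct vertices $v_1,\dots,v_k$ and integers $a_i\in\{1,2\}$, define $f(v_i)=a_i$ for $i\in[k]$ and $f(v)=3$ for all other vertices; $G$ is $(a_1,\dots,a_k)$-AT extendable (resp. $(a_1,\dots,a_k)$-list extendable) with respect to $(v_1,\dots,v_k)$ if $G$ is $f$-AT (resp. $f$-choosable). For $n\in\mathbb{N}$, the chain of diamonds $D_n$ is the graph with vertex set $\{u_i,v_i,w_i:i\in[n]\}\cup\{u_0\}$ and edge set $\{u_{i-1}v_i,u_{i-1}w_i,v_iw_i,v_iu_i,w_iu_i: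 i\in[n]\}$; let $U(D_n)=\{u_0,\dots,u_n\}$. A set $X$ of distinct vertices of $G$ is connected by a chain of diamonds if there exist $n\in\mathbb{N}$ and a graph homomorphism $\varphi:D_n\to G$ with $X\subseteq\varphi(U(D_n))$. *)

theory Defs
  imports Main
begin

text \<open>A finite simple graph: finite vertex set V and edge set E of 2-element subsets of V.\<close>
definition simple_graph :: "'a set \<Rightarrow> 'a set set \<Rightarrow> bool" where
  "simple_graph V E \<longleftrightarrow> finite V \<and> (\<forall>e\<in>E. e \<subseteq> V \<and> card e = 2)"

text \<open>Orientation: a set of arcs containing exactly one orientation of every edge and nothing else.\<close>
definition is_orientation :: "'a set set \<Rightarrow> ('a \<times> 'a) set \<Rightarrow> bool" where
  "is_orientation E D \<longleftrightarrow>
     (\<forall>(u,v)\<in>D. {u,v} \<in> E) \<and> (\<forall>e\<in>E. \<exists>!a. a \<in> D \<and> {fst a, snd a} = e)"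

definition outdeg :: "('a \<times> 'a) set \<Rightarrow> 'a \<Rightarrow> nat" where
  "outdeg F v = card {w. (v,w) \<in> F}"

definition indeg :: "('a \<times> 'a) set \<Rightarrow> 'a \<Rightarrow> nat" where
  "indeg F v = card {w. (w,v) \<in> F}"

text \<open>Eulerian spanning sub-digraph of D (on vertex set V), given by its arc set.\<close>
definition eulerian_sub :: "'a set \<Rightarrow> ('a \<times> 'a) set \<Rightarrow> ('a \<times> 'a) set \<Rightarrow> bool" where
  "eulerian_sub V D F \<longleftrightarrow> F \<subseteq> D \<and> (\<forall>v\<in>V. outdeg F v = indeg F v)"

definition diff :: "'a set \<Rightarrow> ('a \<times> 'a) set \<Rightarrow> int" where
  "diff V D = int (card {F. eulerian_sub V D F \<and> even (card F)})
            - int (card {F. eulerian_sub V D F \<and> odd (card F)})"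

definition AT_orientation :: "'a set \<Rightarrow> ('a \<times> 'a) set \<Rightarrow> bool" where
  "AT_orientation V D \<longleftrightarrow> diff V D \<noteq> 0"

text \<open>G is f-AT: there is an AT-orientation with out-degree at most f(v) - 1 (i.e. < f(v)).\<close>
definition f_AT :: "'a set \<Rightarrow> 'a set set \<Rightarrow> ('a \<Rightarrow> nat) \<Rightarrow> bool" where
  "f_AT V E f \<longleftrightarrow> (\<exists>D. is_orientation E D \<and> AT_orientation V D \<and>
                        (\<forall>v\<in>V. int (outdeg D v) \<le> int (f v) - 1))"

text \<open>(a,b)-AT extendable with respect to (x,y): f(x)=a, f(y)=b, f=3 elsewhere.\<close>
definition AT_extendable2 :: "'a set \<Rightarrow> 'a set set \<Rightarrow> nat \<Rightarrow> nat \<Rightarrow> 'a \<Rightarrow> 'a \<Rightarrow> bool" where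
  "AT_extendable2 V E a b x y \<longleftrightarrow>
     f_AT V E (\<lambda>v. if v = x then a else if v = y then b else 3)"

text \<open>Connectedness of the subgraph induced by S.\<close>
definition connected_in :: "'a set set \<Rightarrow> 'a set \<Rightarrow> bool" where
  "connected_in E S \<longleftrightarrow>
     (\<forall>u\<in>S. \<forall>v\<in>S. (u,v) \<in> ({(p,q). p \<in> S \<and> q \<in> S \<and> {p,q} \<in> E})\<^sup>*)"

text \<open>K4 minor via branch sets: four disjoint nonempty connected vertex sets, pairwise joined by an edge.\<close>
definition has_K4_minor :: "'a set \<Rightarrow> 'a set set \<Rightarrow> bool" where
  "has_K4_minor V E \<longleftrightarrow> (\<exists>B :: nat \<Rightarrow> 'a set.
     (\<forall>i<4. B i \<noteq> {} \<and> B i \<subseteq> V \<and> connected_in E (B i)) \<and>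
     (\<forall>i<4. \<forall>j<4. i \<noteq> j \<longrightarrow> B i \<inter> B j = {} \<and> (\<exists>p\<in>B i. \<exists>q\<in>B j. {p,q} \<in> E)))"

text \<open>X is connected by a chain of diamonds: a homomorphism from D_n, given by the images
  u i (i = 0..n), v i, w i (i = 1..n), with X contained in the image of U(D_n).\<close>
definition connected_by_chain_of_diamonds :: "'a set \<Rightarrow> 'a set set \<Rightarrow> 'a set \<Rightarrow> bool" where
  "connected_by_chain_of_diamonds V E X \<longleftrightarrow> (\<exists>(n::nat) (u::nat \<Rightarrow> 'a) (v::nat \<Rightarrow> 'a) (w::nat \<Rightarrow> 'a).
     (\<forall>i\<le>n. u i \<in> V) \<and> (\<forall>i\<in>{1..n}. v i \<in> V \<and> w i \<in> V) \<and>
     (\<forall>i\<in>{1..n}. {u (i-1), v i} \<in> E \<and> {u (i-1), w i} \<in> E \<and> {v i, w i} \<in> E \<and>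
                   {v i, u i} \<in> E \<and> {w i, u i} \<in> E) \<and>
     X \<subseteq> u ` {0..n})"

end

(*
Up to sign, diff of an orientation with out-degrees g is the coefficient of the monomial with
exponents g in the graph polynomial, so it suffices to find a nonzero coefficient with exponents
below f; this is done by induction on the number of vertices.

A vertex v with deg v < f v can be made a source and deleted.  So let all vertices other than x and
y have degree at least 3.  A K4-minor-free graph has a vertex of degree at most 2 different from y,
hence x has degree at most 2, and the case of degree at most 1 is easy.  Let a, b be the neighbours
of x.  Suppressing a vertex of degree 2 with non-adjacent neighbours keeps all other degrees and
creates no K4 minor, so a and b are adjacent, as otherwise only y could have small degree afterwards.
For the same reason one of them, say a, has exactly one further neighbour d.

If bd is an edge, then x, a, b, d form a diamond, and the coefficient with exponents 1 at x and 2 at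
a is the coefficient for G - x - a with the exponent of d lowered by one: d takes over the role of x.
Otherwise suppression shows that b has exactly one further neighbour e and that de is an edge.  Then
the coefficient with exponents 1, 2, 1 at x, a, b is that of G - x - a - b with the exponent of d
lowered by one, and symmetrically for e.  Since K4-minor-free graphs are 3-colourable and the ends
of a chain of diamonds have the same colour, d and e are not both linked to y by chains of diamonds.
*)

theory Submission
  imports Defs
begin

section \<open>Neighbourhoods and deletion of vertices\<close>

definition nb :: "'a set set \<Rightarrow> 'a \<Rightarrow> 'a set" where
  "nb E v = {w. {v, w} \<in> E}"

definition del :: "'a set set \<Rightarrow> 'a set \<Rightarrow> 'a set set" where
  "del E X = {e \<in> E. e \<inter> X = {}}"

lemma in_nb_commute: "w \<in> nb E v \<longleftrightarrow> v \<in> nb E w"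
  by (simp add: nb_def insert_commute)

lemma nb_subset: "simple_graph V E \<Longrightarrow> nb E v \<subseteq> V"
  by (auto simp: nb_def simple_graph_def)

lemma finite_nb: "simple_graph V E \<Longrightarrow> finite (nb E v)"
  by (meson finite_subset nb_subset simple_graph_def)

lemma not_self_nb: "simple_graph V E \<Longrightarrow> v \<notin> nb E v"
  by (auto simp: nb_def simple_graph_def)

lemma simple_graph_del: "simple_graph V E \<Longrightarrow> simple_graph (V - X) (del E X)"
  by (auto simp: simple_graph_def del_def)

lemma nb_del: "v \<notin> X \<Longrightarrow> nb (del E X) v = nb E v - X"
  by (auto simp: nb_def del_def)

lemma del_subset: "del E X \<subseteq> E"
  by (auto simp: del_def)

lemma del_del: "del (del E X) Y = del E (X \<union> Y)"
  by (auto simp: del_def)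

section \<open>Graphs without a K4 minor\<close>

lemma connected_in_mono:
  assumes "connected_in E S" "E \<subseteq> E'"
  shows "connected_in E' S"
proof -
  have "({(p,q). p \<in> S \<and> q \<in> S \<and> {p,q} \<in> E})\<^sup>* \<subseteq> ({(p,q). p \<in> S \<and> q \<in> S \<and> {p,q} \<in> E'})\<^sup>*"
    using assms(2) by (intro rtrancl_mono) auto
  then show ?thesis using assms(1) unfolding connected_in_def by blast
qed

lemma has_K4_minor_mono:
  assumes "has_K4_minor V E" "V \<subseteq> V'" "E \<subseteq> E'"
  shows "has_K4_minor V' E'"
proof -
  obtain B :: "nat \<Rightarrow> 'a set" where
    B: "\<forall>i<4. B i \<noteq> {} \<and> B i \<subseteq> V \<and> connected_in E (B i)"
       "\<forall>i<4. \<forall>j<4. i \<noteq> j \<longrightarrow> B i \<inter> B j = {} \<and> (\<exists>p\<in>B i. \<exists>q\<in>B j. {p,q} \<in> E)"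
    using assms(1) unfolding has_K4_minor_def by blast
  have "\<forall>i<4. B i \<noteq> {} \<and> B i \<subseteq> V' \<and> connected_in E' (B i)"
    using B(1) assms(2,3) connected_in_mono by fastforce
  moreover have "\<forall>i<4. \<forall>j<4. i \<noteq> j \<longrightarrow> B i \<inter> B j = {} \<and> (\<exists>p\<in>B i. \<exists>q\<in>B j. {p,q} \<in> E')"
    using B(2) assms(3) by (meson subsetD)
  ultimately show ?thesis unfolding has_K4_minor_def by blast
qed

lemma no_K4_minor_del: "\<not> has_K4_minor V E \<Longrightarrow> \<not> has_K4_minor (V - X) (del E X)"
  by (meson Diff_subset del_subset has_K4_minor_mono)

lemma connected_in_segment:
  fixes p :: "nat \<Rightarrow> 'a"
  assumes "\<And>k. s \<le> k \<Longrightarrow> k < l \<Longrightarrow> {p k, p (Suc k)} \<in> E"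
  shows "connected_in E (p ` {s..l})"
proof -
  define R where "R = {(q,r). q \<in> p ` {s..l} \<and> r \<in> p ` {s..l} \<and> {q,r} \<in> E}"
  have "sym R" by (auto simp: R_def sym_def insert_commute)
  then have symR: "sym (R\<^sup>*)" by (rule sym_rtrancl)
  have *: "k \<le> l \<Longrightarrow> (p s, p k) \<in> R\<^sup>*" if "s \<le> k" for k
    using that
  proof (induction k rule: dec_induct)
    case (step k)
    have "(p k, p (Suc k)) \<in> R" using step assms[of k] by (auto simp: R_def)
    then show ?case using step by (meson Suc_leD rtrancl.rtrancl_into_rtrancl)
  qed simp
  have "(p k, p k') \<in> R\<^sup>*" if "k \<in> {s..l}" "k' \<in> {s..l}" for k k'
    using *[of k] *[of k'] that symR by (meson atLeastAtMost_iff rtrancl_trans symD)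
  then show ?thesis unfolding connected_in_def R_def[symmetric] by blast
qed

text \<open>Four named branch sets replace the indexed family, so each unordered pair has to be
  treated only once.\<close>

lemma has_K4_minorI:
  assumes "A \<noteq> {}" "A \<subseteq> V" "connected_in E A"
    and "B \<noteq> {}" "B \<subseteq> V" "connected_in E B"
    and "C \<noteq> {}" "C \<subseteq> V" "connected_in E C"
    and "D \<noteq> {}" "D \<subseteq> V" "connected_in E D"
    and "A \<inter> B = {}" "A \<inter> C = {}" "A \<inter> D = {}" "B \<inter> C = {}" "B \<inter> D = {}" "C \<inter> D = {}"
    and "\<exists>p\<in>A. \<exists>q\<in>B. {p,q} \<in> E" "\<exists>p\<in>A. \<exists>q\<in>C. {p,q} \<in> E" "\<exists>p\<in>A. \<exists>q\<in>D. {p,q} \<in> E"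
    and "\<exists>p\<in>B. \<exists>q\<in>C. {p,q} \<in> E" "\<exists>p\<in>B. \<exists>q\<in>D. {p,q} \<in> E" "\<exists>p\<in>C. \<exists>q\<in>D. {p,q} \<in> E"
  shows "has_K4_minor V E"
proof -
  define M :: "nat \<Rightarrow> 'a set" where
    "M = (\<lambda>i. if i = 0 then A else if i = 1 then B else if i = 2 then C else D)"
  have M: "M 0 = A" "M 1 = B" "M 2 = C" "M 3 = D" by (auto simp: M_def)
  have four: "(\<forall>i<4. P i) \<longleftrightarrow> P 0 \<and> P 1 \<and> P 2 \<and> P 3" for P :: "nat \<Rightarrow> bool"
    by (simp add: numeral_eq_Suc All_less_Suc) blast
  have swap: "\<exists>p\<in>Y. \<exists>q\<in>X. {p,q} \<in> E" if "\<exists>p\<in>X. \<exists>q\<in>Y. {p,q} \<in> E" for X Y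
    using that by (metis insert_commute)
  have "\<forall>i<4. M i \<noteq> {} \<and> M i \<subseteq> V \<and> connected_in E (M i)"
    unfolding four M using assms by blast
  moreover have "\<forall>i<4. \<forall>j<4. i \<noteq> j \<longrightarrow> M i \<inter> M j = {} \<and> (\<exists>p\<in>M i. \<exists>q\<in>M j. {p,q} \<in> E)"
    unfolding four M using assms(13-24) assms(19-24)[THEN swap] by (simp add: Int_commute)
  ultimately show ?thesis unfolding has_K4_minor_def by blast
qed

section \<open>Longest paths and vertices of degree at most 2\<close>

definition path_to :: "'a set set \<Rightarrow> 'a set \<Rightarrow> 'a \<Rightarrow> 'a list \<Rightarrow> bool" where
  "path_to E V t p \<longleftrightarrow> p \<noteq> [] \<and> distinct p \<and> set p \<subseteq> V \<and> last p = t \<and>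
     (\<forall>k. Suc k < length p \<longrightarrow> {p ! k, p ! Suc k} \<in> E)"

lemma path_to_Cons:
  assumes "path_to E V t p" "w \<in> V" "w \<notin> set p" "{w, p ! 0} \<in> E"
  shows "path_to E V t (w # p)"
  using assms by (auto simp: path_to_def nth_Cons split: nat.splits)

text \<open>A Posa rotation: the chord from \<open>p ! 0\<close> to \<open>p ! i\<close> replaces
  the path edge before \<open>p ! i\<close>. Vertex set, length and end \<open>t\<close> stay fixed,
  so a longest path stays longest; the new start is \<open>p ! (i - 1)\<close>.\<close>

lemma path_to_rotate:
  assumes p: "path_to E V t p" and i: "0 < i" "i < length p" "{p ! 0, p ! i} \<in> E"
  shows "path_to E V t (rev (take i p) @ drop i p)"
proof -
  let ?q = "rev (take i p) @ drop i p"
  have q: "?q ! k = (if k < i then p ! (i - 1 - k) else p ! k)" if "k < length p" for k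
    using that i by (auto simp: nth_append rev_nth min_def)
  have mset: "set ?q = set p"
    by (metis append_take_drop_id set_append set_rev)
  have "distinct ?q"
    using p by (metis append_take_drop_id distinct_append distinct_rev path_to_def set_rev)
  moreover have "{?q ! k, ?q ! Suc k} \<in> E" if k: "Suc k < length ?q" for k
  proof -
    have len: "Suc k < length p" using k i by simp
    have edge: "{p ! m, p ! Suc m} \<in> E" if "Suc m < length p" for m
      using p that by (auto simp: path_to_def)
    consider "Suc k < i" | "Suc k = i" | "i \<le> k" by linarith
    then show ?thesis
    proof cases
      case 1
      then have "Suc (i - 1 - Suc k) = i - 1 - k" by simp
      then show ?thesis using q[of k] q[of "Suc k"] len 1 edge[of "i - 1 - Suc k"] i
        by (simp add: insert_commute)
    next
      case 2
      then show ?thesis using q[of k] q[of "Suc k"] len i by auto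
    next
      case 3
      then show ?thesis using q[of k] q[of "Suc k"] len edge[of k] by simp
    qed
  qed
  moreover have "last ?q = t" using p i by (simp add: path_to_def)
  ultimately show ?thesis using p mset i by (auto simp: path_to_def)
qed

lemma third_element:
  assumes "finite A" "3 \<le> card A"
  shows "\<exists>w\<in>A. w \<noteq> b \<and> w \<noteq> c"
proof (rule ccontr)
  assume "\<not> ?thesis"
  then have "A \<subseteq> {b, c}" by auto
  then have "card A \<le> card {b, c}" by (intro card_mono) auto
  also have "\<dots> \<le> 2" by (simp add: card_insert_if)
  finally show False using assms by simp
qed

text \<open>Rotating a longest path at the first chord of its initial vertex p0, say p0 pi, moves p(i-1) to
  the front.  When i is minimal over all longest paths, p0 and p(i-1) both have a neighbour beyond
  pi, and these two chords cross.\<close>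

lemma K4_minor_of_min_degree:
  assumes G: "simple_graph V E" and t: "nb E t \<noteq> {}"
    and deg: "\<And>v. v \<noteq> t \<Longrightarrow> nb E v \<noteq> {} \<Longrightarrow> 3 \<le> card (nb E v)"
  shows "has_K4_minor V E"
proof -
  obtain s where s: "{s, t} \<in> E" using t by (auto simp: nb_def insert_commute)
  have st: "s \<in> V" "t \<in> V" "s \<noteq> t" using s G by (auto simp: simple_graph_def)
  have fV: "finite V" using G by (simp add: simple_graph_def)
  have bound: "\<forall>p. path_to E V t p \<longrightarrow> length p < Suc (card V)"
    using fV by (metis card_mono distinct_card path_to_def less_Suc_eq_le)
  have tt: "path_to E V t [t]" using st by (simp add: path_to_def)
  obtain q where q: "path_to E V t q"
    and qmax: "\<And>p. path_to E V t p \<Longrightarrow> length p \<le> length q"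
    using ex_has_greatest_nat[of "path_to E V t", OF tt bound] by blast
  have "path_to E V t [s, t]" using s st by (auto simp: path_to_def less_Suc_eq)
  then have len: "2 \<le> length q" using qmax by fastforce
  \<comment> \<open>A longest path cannot be extended at its start, so all neighbours of
    \<open>p ! 0\<close> lie on it. Degree 3 leaves one that is neither \<open>p ! 1\<close> nor the
    freely chosen \<open>z\<close>.\<close>
  have head: "\<exists>k\<ge>2. k < length p \<and> {p ! 0, p ! k} \<in> E \<and> p ! k \<noteq> z"
    if p: "path_to E V t p" "length p = length q" for p z
  proof -
    have hd: "{p ! 0, p ! 1} \<in> E" using p len by (auto simp: path_to_def)
    have "p ! 0 \<noteq> t"
    proof
      assume "p ! 0 = t"
      then have "p ! 0 = p ! (length p - 1)" using p by (metis last_conv_nth path_to_def)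
      moreover have "distinct p" "0 < length p" "length p - 1 < length p"
        using p len by (auto simp: path_to_def)
      ultimately have "0 = length p - 1" using nth_eq_iff_index_eq by metis
      then show False using p len by simp
    qed
    then have "3 \<le> card (nb E (p ! 0))" using deg hd by (auto simp: nb_def)
    then obtain w where w: "w \<in> nb E (p ! 0)" "w \<noteq> p ! 1" "w \<noteq> z"
      using third_element finite_nb[OF G] by metis
    have wV: "w \<in> V" using nb_subset[OF G] w by blast
    have "w \<in> set p"
    proof (rule ccontr)
      assume "w \<notin> set p"
      then have "path_to E V t (w # p)" using path_to_Cons[OF p(1) wV] w
        by (simp add: nb_def insert_commute)
      then show False using qmax p(2) by fastforce
    qed
    then obtain k where k: "k < length p" "p ! k = w" by (auto simp: in_set_conv_nth)
    have "k \<noteq> 0" using not_self_nb[OF G] w k by metis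
    moreover have "k \<noteq> 1" using w k by metis
    ultimately show ?thesis using k w by (intro exI[of _ k]) (auto simp: nb_def)
  qed
  \<comment> \<open>The chord index is minimised over all longest paths to \<open>t\<close>
    together, so that the minimum also bounds the chords of the rotated path.\<close>
  define Q where "Q = (\<lambda>(p, i). path_to E V t p \<and> length p = length q \<and> 2 \<le> i \<and> i < length p \<and>
    {p ! 0, p ! i} \<in> E)"
  obtain i0 where "2 \<le> i0" "i0 < length q" "{q ! 0, q ! i0} \<in> E"
    using head[OF q refl, of t] by blast
  then have Q0: "Q (q, i0)" using q by (simp add: Q_def)
  obtain pi where "Q pi" and least: "\<And>p' i'. Q (p', i') \<Longrightarrow> snd pi \<le> i'"
    using ex_has_least_nat[of Q, OF Q0, of snd] by (metis snd_conv)
  then obtain p i where pi: "pi = (p, i)" and Q: "Q (p, i)" by (cases pi) auto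
  have p: "path_to E V t p" "length p = length q" and i: "2 \<le> i" "i < length p" "{p ! 0, p ! i} \<in> E"
    using Q by (auto simp: Q_def)
  obtain j where j: "j \<ge> 2" "j < length p" "{p ! 0, p ! j} \<in> E" "p ! j \<noteq> p ! i"
    using head[OF p] by blast
  have "Q (p, j)" using j p by (simp add: Q_def)
  then have ij: "i < j" using least[of p j] j(4) pi by (cases "i = j") auto
  let ?r = "rev (take i p) @ drop i p"
  have r: "path_to E V t ?r" "length ?r = length q"
    using path_to_rotate[OF p(1) _ i(2,3)] i p by auto
  have rnth: "?r ! k = (if k < i then p ! (i - 1 - k) else p ! k)" if "k < length p" for k
    using that i by (auto simp: nth_append rev_nth min_def)
  obtain m where m: "m \<ge> 2" "m < length ?r" "{?r ! 0, ?r ! m} \<in> E" "?r ! m \<noteq> p ! i"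
    using head[OF r] by blast
  have "Q (?r, m)" using m r by (simp add: Q_def)
  then have "i \<le> m" using least[of ?r m] pi by simp
  moreover have "m \<noteq> i" using m rnth[of m] i by auto
  ultimately have im: "i < m" by simp
  have mlen: "m < length p" using m(2) r(2) p(2) by simp
  have len0: "0 < length p" using i by linarith
  \<comment> \<open>From index \<open>i\<close> on, the rotated path agrees with \<open>p\<close>;
    its chord is therefore an edge of the graph from \<open>p ! (i - 1)\<close> to a vertex of
    \<open>p\<close> beyond \<open>p ! i\<close>.\<close>
  have "?r ! 0 = p ! (i - 1)" "?r ! m = p ! m" using rnth[OF len0] rnth[OF mlen] im i(1) by auto
  then have mE: "{p ! (i - 1), p ! m} \<in> E" using m(3) by metis
  \<comment> \<open>The order of \<open>j\<close> and \<open>m\<close> is unknown. The segment from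
    \<open>s\<close> to \<open>l\<close> contains both far chord ends and becomes the fourth branch
    set, after the segments \<open>0..0\<close>, \<open>1..i-1\<close> and
    \<open>i..s-1\<close>.\<close>
  define s where "s = min j m"
  define l where "l = max j m"
  have sl: "i < s" "s \<le> l" "l < length p" using ij im j(2) mlen by (auto simp: s_def l_def)
  have jm: "j \<in> {s..l}" "m \<in> {s..l}" by (auto simp: s_def l_def)
  have path: "{p ! k, p ! Suc k} \<in> E" if "Suc k < length p" for k
    using p that by (auto simp: path_to_def)
  have inj: "inj_on ((!) p) {..<length p}"
    using p by (auto simp: path_to_def inj_on_def nth_eq_iff_index_eq)
  have disj: "(!) p ` X \<inter> (!) p ` Y = {}"
    if "X \<inter> Y = {}" "X \<subseteq> {..<length p}" "Y \<subseteq> {..<length p}" for X Y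
    using inj_on_image_Int[OF inj that(2,3)] that(1) by simp
  have sub: "(!) p ` X \<subseteq> V" if "X \<subseteq> {..<length p}" for X
    using that p by (force simp: path_to_def)
  have conn: "connected_in E ((!) p ` {a..b})" if "b < length p" for a b
    using that by (intro connected_in_segment path) auto
  have edge: "\<exists>a\<in>(!) p ` X. \<exists>b\<in>(!) p ` Y. {a, b} \<in> E"
    if "{p ! k, p ! k'} \<in> E" "k \<in> X" "k' \<in> Y" for X Y k k'
    using that by blast
  have e01: "{p ! 0, p ! 1} \<in> E" using path[of 0] i by simp
  have e12: "{p ! (i - 1), p ! i} \<in> E" using path[of "i - 1"] i by simp
  have e23: "{p ! (s - 1), p ! s} \<in> E" using path[of "s - 1"] i sl by simp
  show ?thesis
  proof (rule has_K4_minorI)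
    show "\<exists>a\<in>(!) p ` {0..0}. \<exists>b\<in>(!) p ` {1..i-1}. {a, b} \<in> E"
      by (rule edge[OF e01]) (use i in auto)
    show "\<exists>a\<in>(!) p ` {0..0}. \<exists>b\<in>(!) p ` {i..s-1}. {a, b} \<in> E"
      by (rule edge[OF i(3)]) (use sl in auto)
    show "\<exists>a\<in>(!) p ` {0..0}. \<exists>b\<in>(!) p ` {s..l}. {a, b} \<in> E"
      by (rule edge[OF j(3)]) (use jm in auto)
    show "\<exists>a\<in>(!) p ` {1..i-1}. \<exists>b\<in>(!) p ` {i..s-1}. {a, b} \<in> E"
      by (rule edge[OF e12]) (use i sl in auto)
    show "\<exists>a\<in>(!) p ` {1..i-1}. \<exists>b\<in>(!) p ` {s..l}. {a, b} \<in> E"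
      by (rule edge[OF mE]) (use i jm in auto)
    show "\<exists>a\<in>(!) p ` {i..s-1}. \<exists>b\<in>(!) p ` {s..l}. {a, b} \<in> E"
      by (rule edge[OF e23]) (use i sl in auto)
    show "(!) p ` {0..0} \<subseteq> V" "(!) p ` {1..i-1} \<subseteq> V" "(!) p ` {i..s-1} \<subseteq> V" "(!) p ` {s..l} \<subseteq> V"
      by (rule sub; use i sl in auto)+
    show "connected_in E ((!) p ` {0..0})" "connected_in E ((!) p ` {1..i-1})"
      "connected_in E ((!) p ` {i..s-1})" "connected_in E ((!) p ` {s..l})"
      by (rule conn; use i sl in linarith)+
    show "(!) p ` {0..0} \<inter> (!) p ` {1..i-1} = {}" "(!) p ` {0..0} \<inter> (!) p ` {i..s-1} = {}"
      "(!) p ` {0..0} \<inter> (!) p ` {s..l} = {}" "(!) p ` {1..i-1} \<inter> (!) p ` {i..s-1} = {}"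
      "(!) p ` {1..i-1} \<inter> (!) p ` {s..l} = {}" "(!) p ` {i..s-1} \<inter> (!) p ` {s..l} = {}"
      by (rule disj; use i sl in auto)+
  qed (use i sl in auto)
qed

text \<open>The exempt vertex \<open>r\<close> serves as the fixed path end \<open>t\<close> in
  \<open>K4_minor_of_min_degree\<close>.\<close>

lemma low_degree_vertex:
  assumes G: "simple_graph V E" and K: "\<not> has_K4_minor V E" and u: "u \<in> V" "u \<noteq> r"
  shows "\<exists>v\<in>V. v \<noteq> r \<and> card (nb E v) \<le> 2"
proof (rule ccontr)
  assume "\<not> ?thesis"
  then have deg: "3 \<le> card (nb E v)" if "v \<in> V" "v \<noteq> r" for v using that by force
  have nV: "v \<in> V" if "nb E v \<noteq> {}" for v
    using that G by (auto simp: nb_def simple_graph_def)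
  show False
  proof (cases "nb E r = {}")
    case True
    \<comment> \<open>An isolated \<open>r\<close> cannot be a path end, but then every non-isolated
      vertex has degree at least 3 and \<open>u\<close> can take its place.\<close>
    have "nb E u \<noteq> {}" using deg[OF u] by auto
    moreover have "3 \<le> card (nb E v)" if "nb E v \<noteq> {}" for v
      using that deg[OF nV[OF that]] True by blast
    ultimately show ?thesis using K4_minor_of_min_degree[OF G, of u] K by blast
  next
    case False
    then show ?thesis using K4_minor_of_min_degree[OF G, of r] deg nV K by blast
  qed
qed

section \<open>Suppressing a vertex of degree 2\<close>

lemma K4_minor_suppress:
  assumes K: "has_K4_minor (V - {v}) (insert {a, b} (del E {v}))"
    and v: "v \<in> V" "{v, a} \<in> E" "{v, b} \<in> E"
  shows "has_K4_minor V E"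
proof -
  define E' where "E' = insert {a, b} (del E {v})"
  obtain B :: "nat \<Rightarrow> 'a set" where
    B: "\<And>i. i < 4 \<Longrightarrow> B i \<noteq> {} \<and> B i \<subseteq> V - {v} \<and> connected_in E' (B i)"
       "\<And>i j. i < 4 \<Longrightarrow> j < 4 \<Longrightarrow> i \<noteq> j \<Longrightarrow> B i \<inter> B j = {} \<and> (\<exists>p\<in>B i. \<exists>q\<in>B j. {p,q} \<in> E')"
    using K unfolding has_K4_minor_def E'_def by metis
  \<comment> \<open>The branch set containing a absorbs v; the edges va and vb then replace ab.\<close>
  define C where "C i = (if a \<in> B i then insert v (B i) else B i)" for i
  have "C i \<noteq> {} \<and> C i \<subseteq> V \<and> connected_in E (C i)" if i: "i < 4" for i
  proof -
    define R where "R = {(p,q). p \<in> C i \<and> q \<in> C i \<and> {p,q} \<in> E}"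
    have symR: "sym (R\<^sup>*)" by (rule sym_rtrancl) (auto simp: R_def sym_def insert_commute)
    have ab: "(a, b) \<in> R\<^sup>*" if "a \<in> B i" "b \<in> B i"
    proof -
      have "(a, v) \<in> R" "(v, b) \<in> R" using that v by (auto simp: R_def C_def insert_commute)
      then show ?thesis by (meson r_into_rtrancl rtrancl.rtrancl_into_rtrancl)
    qed
    have "{(p,q). p \<in> B i \<and> q \<in> B i \<and> {p,q} \<in> E'} \<subseteq> R\<^sup>*"
    proof clarify
      fix p q assume pq: "p \<in> B i" "q \<in> B i" "{p, q} \<in> E'"
      then consider "{p, q} \<in> E" | "p = a" "q = b" | "p = b" "q = a"
        by (auto simp: E'_def del_def doubleton_eq_iff)
      then show "(p, q) \<in> R\<^sup>*"
      proof cases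
        case 1
        then have "(p, q) \<in> R" using pq by (auto simp: R_def C_def)
        then show ?thesis by blast
      next
        case 2
        then show ?thesis using ab pq by blast
      next
        case 3
        then show ?thesis using ab pq symD[OF symR] by blast
      qed
    qed
    then have "({(p,q). p \<in> B i \<and> q \<in> B i \<and> {p,q} \<in> E'})\<^sup>* \<subseteq> R\<^sup>*"
      by (rule rtrancl_subset_rtrancl)
    then have BR: "(p, q) \<in> R\<^sup>*" if "p \<in> B i" "q \<in> B i" for p q
      using B(1)[OF i] that unfolding connected_in_def by blast
    have av: "(a, v) \<in> R\<^sup>*" if "a \<in> B i"
      using that v by (intro r_into_rtrancl) (auto simp: R_def C_def insert_commute)
    have "(p, a) \<in> R\<^sup>*" "(a, p) \<in> R\<^sup>*" if "p \<in> C i" "a \<in> B i" for p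
      using that BR[of p a] BR[of a p] av symD[OF symR av] by (cases "p = v"; simp add: C_def)+
    then have "(p, q) \<in> R\<^sup>*" if "p \<in> C i" "q \<in> C i" for p q
      using that BR by (cases "a \<in> B i") (meson rtrancl_trans, simp add: C_def)
    then have "connected_in E (C i)" unfolding connected_in_def R_def by blast
    then show ?thesis using B(1)[OF i] v by (auto simp: C_def)
  qed
  moreover have "C i \<inter> C j = {} \<and> (\<exists>p\<in>C i. \<exists>q\<in>C j. {p,q} \<in> E)"
    if ij: "i < 4" "j < 4" "i \<noteq> j" for i j
  proof -
    have dis: "B i \<inter> B j = {}" using B(2) ij by blast
    then have "C i \<inter> C j = {}" using B(1)[OF ij(1)] B(1)[OF ij(2)] by (auto simp: C_def)
    moreover obtain p q where pq: "p \<in> B i" "q \<in> B j" "{p,q} \<in> E'" using B(2) ij by blast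
    then consider "{p, q} \<in> E" | "p = a" "q = b" | "p = b" "q = a"
      by (auto simp: E'_def del_def doubleton_eq_iff)
    then have "\<exists>p\<in>C i. \<exists>q\<in>C j. {p,q} \<in> E"
    proof cases
      case 1
      then show ?thesis using pq by (auto simp: C_def)
    next
      case 2
      then have "v \<in> C i" "b \<in> C j" using pq by (auto simp: C_def)
      then show ?thesis using v by blast
    next
      case 3
      then have "v \<in> C j" "b \<in> C i" using pq by (auto simp: C_def)
      then show ?thesis using v by (metis insert_commute)
    qed
    ultimately show ?thesis by blast
  qed
  ultimately show ?thesis unfolding has_K4_minor_def
    by (intro exI[of _ C] conjI allI impI) simp_all
qed

text \<open>Degrees survive because \<open>a\<close> and \<open>b\<close> each lose the neighbour
  \<open>v\<close> and gain one another, a real gain since they were not adjacent. Minimum degree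
  conditions thus pass to the smaller graph.\<close>

lemma suppress:
  assumes G: "simple_graph V E" and K: "\<not> has_K4_minor V E"
    and nv: "nb E v = {a, b}" "a \<noteq> b" "{a, b} \<notin> E"
  defines "E' \<equiv> insert {a, b} (del E {v})"
  shows "simple_graph (V - {v}) E'" "\<not> has_K4_minor (V - {v}) E'"
    and "\<And>w. w \<noteq> v \<Longrightarrow> nb E' w = (if w = a then insert b (nb E a - {v}) else
            if w = b then insert a (nb E b - {v}) else nb E w)"
    and "\<And>w. w \<noteq> v \<Longrightarrow> card (nb E' w) = card (nb E w)"
proof -
  have e: "{v, a} \<in> E" "{v, b} \<in> E" using nv(1) by (auto simp: nb_def)
  then have d: "v \<in> V" "v \<noteq> a" "v \<noteq> b" "a \<in> V" "b \<in> V"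
    using G by (auto simp: simple_graph_def)
  show "simple_graph (V - {v}) E'"
    using simple_graph_del[OF G, of "{v}"] d nv(2) by (auto simp: simple_graph_def E'_def)
  show "\<not> has_K4_minor (V - {v}) E'"
    using K4_minor_suppress[OF _ d(1) e] K unfolding E'_def by blast
  have nbv: "{w, v} \<in> E \<longleftrightarrow> w = a \<or> w = b" for w
  proof -
    have "{w, v} \<in> E \<longleftrightarrow> w \<in> nb E v" by (simp add: nb_def insert_commute)
    then show ?thesis using nv(1) by simp
  qed
  show *: "nb E' w = (if w = a then insert b (nb E a - {v}) else
      if w = b then insert a (nb E b - {v}) else nb E w)" if "w \<noteq> v" for w
    using that nv(2) d nbv by (auto simp: nb_def E'_def del_def doubleton_eq_iff)
  have fin: "finite (nb E w)" for w using finite_nb[OF G] .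
  have c: "v \<in> nb E a" "v \<in> nb E b" "b \<notin> nb E a" "a \<notin> nb E b"
    using e nv(3) by (auto simp: nb_def insert_commute)
  show "card (nb E' w) = card (nb E w)" if "w \<noteq> v" for w
    using *[OF that] c fin by (auto simp: card_insert_if card_Suc_Diff1 simp del: card_Diff_insert)
qed

lemma degree_two_nbs_adjacent:
  assumes G: "simple_graph V E" and K: "\<not> has_K4_minor V E"
    and nv: "nb E v = {a, b}" "a \<noteq> b"
    and deg: "\<And>w. w \<in> V \<Longrightarrow> w \<noteq> v \<Longrightarrow> w \<noteq> r \<Longrightarrow> 3 \<le> card (nb E w)"
  shows "{a, b} \<in> E"
proof (rule ccontr)
  assume ab: "{a, b} \<notin> E"
  note s = suppress[OF G K nv ab]
  \<comment> \<open>Of the two vertices \<open>a\<close> and \<open>b\<close>, at least one differs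
    from \<open>r\<close>, as \<open>low_degree_vertex\<close> requires.\<close>
  have "a \<in> V - {v}" "b \<in> V - {v}"
    using nv nb_subset[OF G, of v] not_self_nb[OF G, of v] by auto
  then obtain u where u: "u \<in> V - {v}" "u \<noteq> r" using nv(2) by metis
  obtain w where "w \<in> V - {v}" "w \<noteq> r" "card (nb (insert {a, b} (del E {v})) w) \<le> 2"
    using low_degree_vertex[OF s(1,2) u] by blast
  then show False using s(4)[of w] deg[of w] by auto
qed

text \<open>Greedy colouring: a vertex of degree at most 2 always finds one of three colours
  free.\<close>

lemma three_colouring:
  assumes "simple_graph V E" "\<not> has_K4_minor V E"
  shows "\<exists>c :: 'a \<Rightarrow> nat. (\<forall>v. c v < 3) \<and> (\<forall>p q. {p, q} \<in> E \<longrightarrow> c p \<noteq> c q)"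
  using assms
proof (induction "card V" arbitrary: V E rule: less_induct)
  case less
  note G = less.prems(1) and K = less.prems(2)
  show ?case
  proof (cases "V = {}")
    case True
    then have "E = {}" using G True by (auto simp: simple_graph_def)
    then show ?thesis by (intro exI[of _ "\<lambda>_. 0"]) auto
  next
    case False
    have "\<exists>v\<in>V. card (nb E v) \<le> 2"
    proof (cases "\<exists>u w. u \<in> V \<and> w \<in> V \<and> u \<noteq> w")
      case True
      then show ?thesis using low_degree_vertex[OF G K] by metis
    next
      \<comment> \<open>\<open>low_degree_vertex\<close> asks for a vertex besides \<open>r\<close>;
        a graph with a single vertex has to be treated apart.\<close>
      case small: False
      obtain u where u: "u \<in> V" using False by blast
      then have "nb E u = {}" using small nb_subset[OF G, of u] not_self_nb[OF G, of u] by blast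
      then show ?thesis using u by (intro bexI[of _ u]) auto
    qed
    then obtain v where v: "v \<in> V" "card (nb E v) \<le> 2" by blast
    have "card (V - {v}) < card V" using v G by (metis card_Diff1_less simple_graph_def)
    then obtain c :: "'a \<Rightarrow> nat" where c: "\<And>w. c w < 3"
      "\<And>p q. {p, q} \<in> del E {v} \<Longrightarrow> c p \<noteq> c q"
      using less.hyps simple_graph_del[OF G] no_K4_minor_del[OF K] by metis
    have "card (c ` nb E v) \<le> 2" using v card_image_le[OF finite_nb[OF G]] le_trans by blast
    then have "\<not> {..<3} \<subseteq> c ` nb E v"
      using card_mono[of "c ` nb E v" "{..<3}"] finite_nb[OF G, of v] by auto
    then obtain k where k: "k < 3" "k \<notin> c ` nb E v" by auto
    have "(c(v := k)) p \<noteq> (c(v := k)) q" if "{p, q} \<in> E" for p q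
    proof -
      have "p \<noteq> q" using that not_self_nb[OF G] by (auto simp: nb_def)
      then show ?thesis using that k c(2)[of p q] by (auto simp: nb_def del_def insert_commute)
    qed
    then show ?thesis using k c by (intro exI[of _ "c(v := k)"]) auto
  qed
qed

section \<open>Chains of diamonds\<close>

text \<open>The pairs of ends of homomorphic images of one diamond; chains become the
  reflexive-transitive closure, which is monotone in the edge set.\<close>

definition dia :: "'a set set \<Rightarrow> ('a \<times> 'a) set" where
  "dia E = {(p, q). \<exists>v w. {p,v} \<in> E \<and> {p,w} \<in> E \<and> {v,w} \<in> E \<and> {v,q} \<in> E \<and> {w,q} \<in> E}"

lemma chain_if_dia_rtrancl:
  assumes G: "simple_graph V E" and "(x, y) \<in> (dia E)\<^sup>*" and x: "x \<in> V"
  shows "connected_by_chain_of_diamonds V E {x, y}"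
proof -
  from assms(2) obtain n where "(x, y) \<in> dia E ^^ n" using rtrancl_imp_relpow by blast
  then obtain u where u: "u 0 = x" "u n = y" "\<And>i. i < n \<Longrightarrow> (u i, u (Suc i)) \<in> dia E"
    by (auto simp: relpow_fun_conv)
  have "\<exists>v w. {u i,v} \<in> E \<and> {u i,w} \<in> E \<and> {v,w} \<in> E \<and> {v,u (Suc i)} \<in> E \<and> {w,u (Suc i)} \<in> E"
    if "i < n" for i using u(3)[OF that] by (simp add: dia_def)
  then obtain v w where vw: "\<And>i. i < n \<Longrightarrow> {u i,v i} \<in> E \<and> {u i,w i} \<in> E \<and> {v i,w i} \<in> E \<and>
      {v i,u (Suc i)} \<in> E \<and> {w i,u (Suc i)} \<in> E" by metis
  have EV: "p \<in> V \<and> q \<in> V" if "{p, q} \<in> E" for p q using that G by (auto simp: simple_graph_def)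
  have uV: "u i \<in> V" if "i \<le> n" for i
  proof (cases i)
    case (Suc j)
    then show ?thesis using vw[of j] EV that by (metis Suc_le_lessD)
  qed (use x u(1) in simp)
  have e: "{u (i-1), v (i-1)} \<in> E \<and> {u (i-1), w (i-1)} \<in> E \<and> {v (i-1), w (i-1)} \<in> E \<and>
                   {v (i-1), u i} \<in> E \<and> {w (i-1), u i} \<in> E" if "i \<in> {1..n}" for i
    using vw[of "i - 1"] that by auto
  show ?thesis
    unfolding connected_by_chain_of_diamonds_def
  \<comment> \<open>The middle vertices chosen above are indexed from 0, those of a chain from 1,
    hence the shift.\<close>
  proof (rule exI[of _ n], rule exI[of _ u], rule exI[of _ "\<lambda>i. v (i - 1)"], rule exI[of _ "\<lambda>i. w (i - 1)"], intro conjI)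
    show "\<forall>i\<in>{1..n}. v (i - 1) \<in> V \<and> w (i - 1) \<in> V" using e EV by blast
    show "{x, y} \<subseteq> u ` {0..n}" using u(1,2) by auto
  qed (use uV e in auto)
qed

lemma dia_mono: "E \<subseteq> E' \<Longrightarrow> dia E \<subseteq> dia E'"
  unfolding dia_def by blast

text \<open>The two adjacent middle vertices of a diamond use up two colours, which forces the third
  on both ends.\<close>

lemma dia_same_colour:
  fixes c :: "'a \<Rightarrow> nat"
  assumes "(p, q) \<in> (dia E)\<^sup>*" "\<And>v. c v < 3" "\<And>p q. {p, q} \<in> E \<Longrightarrow> c p \<noteq> c q"
  shows "c p = c q"
  using assms(1)
proof (induction rule: rtrancl_induct)
  case (step q r)
  have vals: "c z = 0 \<or> c z = 1 \<or> c z = 2" for z using assms(2)[of z] by linarith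
  from step obtain v w where "{q,v} \<in> E" "{q,w} \<in> E" "{v,w} \<in> E" "{v,r} \<in> E" "{w,r} \<in> E"
    by (auto simp: dia_def)
  then have "c q \<noteq> c v" "c q \<noteq> c w" "c v \<noteq> c w" "c v \<noteq> c r" "c w \<noteq> c r" using assms(3) by auto
  then have "c q = c r"
    using vals[of q] vals[of r] vals[of v] vals[of w] by (elim disjE) simp_all
  then show ?case using step by simp
qed simp

section \<open>Coefficients of the graph polynomial\<close>

text \<open>The coefficient of the monomial with exponent vector g in the product of x_u - x_v over all arcs
  (u,v) of the list; exponents are integers so that negative ones need no special treatment.\<close>

fun coef :: "('a \<times> 'a) list \<Rightarrow> ('a \<Rightarrow> int) \<Rightarrow> int" where
  "coef [] g = (if g = (\<lambda>_. 0) then 1 else 0)"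
| "coef ((u, v) # as) g = coef as (g(u := g u - 1)) - coef as (g(v := g v - 1))"

definition edge :: "'a \<times> 'a \<Rightarrow> 'a set" where
  "edge a = {fst a, snd a}"

lemma edge_Pair [simp]: "edge (u, v) = {u, v}"
  by (simp add: edge_def)

text \<open>Reversing F changes the out-degree of w by indeg F w - outdeg F w, so the flow collects the
  signed sub-digraphs whose reversal changes all out-degrees by g; for g = 0 this is diff.\<close>

definition flow :: "('a \<times> 'a) set \<Rightarrow> ('a \<Rightarrow> int) \<Rightarrow> int" where
  "flow D g = (\<Sum>F\<in>Pow D. if \<forall>w. int (indeg F w) - int (outdeg F w) = g w then (-1) ^ card F else 0)"

lemma outdeg_insert:
  assumes "finite F" "(u, v) \<notin> F"
  shows "outdeg (insert (u, v) F) w = outdeg F w + (if w = u then 1 else 0)"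
proof -
  have "finite {z. (w, z) \<in> F}"
    by (rule finite_subset[of _ "snd ` F"]) (use assms in force)+
  moreover have "{z. (w, z) \<in> insert (u, v) F} =
      (if w = u then insert v {z. (w, z) \<in> F} else {z. (w, z) \<in> F})"
    by auto
  ultimately show ?thesis using assms(2) by (auto simp: outdeg_def)
qed

lemma indeg_insert:
  assumes "finite F" "(u, v) \<notin> F"
  shows "indeg (insert (u, v) F) w = indeg F w + (if w = v then 1 else 0)"
proof -
  have "finite {z. (z, w) \<in> F}"
    by (rule finite_subset[of _ "fst ` F"]) (use assms in force)+
  moreover have "{z. (z, w) \<in> insert (u, v) F} =
      (if w = v then insert u {z. (z, w) \<in> F} else {z. (z, w) \<in> F})"
    by auto
  ultimately show ?thesis using assms(2) by (auto simp: indeg_def)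
qed

text \<open>Split the sub-digraphs by whether they contain the new arc. Taking it out flips the sign
  and shifts the required imbalance by one at \<open>u\<close> and at \<open>v\<close>.\<close>

lemma flow_insert:
  assumes D: "finite D" "(u, v) \<notin> D" and uv: "u \<noteq> v"
  shows "flow (insert (u, v) D) g = flow D g - flow D (g(u := g u + 1, v := g v - 1))"
proof -
  let ?a = "(u, v)"
  let ?h = "\<lambda>g F. if \<forall>w. int (indeg F w) - int (outdeg F w) = g w then (-1) ^ card F else (0::int)"
  have inj: "inj_on (insert ?a) (Pow D)"
    using D(2) by (intro inj_onI) (metis Diff_insert_absorb PowD subset_iff)
  have "flow (insert ?a D) g = (\<Sum>F\<in>Pow D. ?h g F) + (\<Sum>F\<in>insert ?a ` Pow D. ?h g F)"
    unfolding flow_def Pow_insert using D by (intro sum.union_disjoint) auto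
  also have "(\<Sum>F\<in>insert ?a ` Pow D. ?h g F) = (\<Sum>F\<in>Pow D. ?h g (insert ?a F))"
    using inj by (simp add: sum.reindex)
  also have "\<dots> = (\<Sum>F\<in>Pow D. - ?h (g(u := g u + 1, v := g v - 1)) F)"
  proof (rule sum.cong[OF refl])
    fix F assume "F \<in> Pow D"
    then have F: "finite F" "?a \<notin> F" using D finite_subset by auto
    have "(\<forall>w. int (indeg (insert ?a F) w) - int (outdeg (insert ?a F) w) = g w) \<longleftrightarrow>
       (\<forall>w. int (indeg F w) - int (outdeg F w) = (g(u := g u + 1, v := g v - 1)) w)"
      using uv by (intro all_cong1) (auto simp: outdeg_insert[OF F] indeg_insert[OF F])
    then show "?h g (insert ?a F) = - ?h (g(u := g u + 1, v := g v - 1)) F"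
      using F by (simp del: fun_upd_apply)
  qed
  finally show ?thesis by (simp add: flow_def sum_negf del: fun_upd_apply)
qed

text \<open>A term of the expanded product is given by the set F of arcs that contribute their head.
  It has sign \<open>(-1) ^ card F\<close> and its exponents are the out-degrees changed by
  \<open>indeg F - outdeg F\<close>. Formally, both sides satisfy the same recursion.\<close>

lemma coef_eq_flow:
  assumes "distinct as" "\<forall>(u, v)\<in>set as. u \<noteq> v"
  shows "coef as g = flow (set as) (\<lambda>w. g w - int (outdeg (set as) w))"
  using assms
proof (induction as arbitrary: g)
  case Nil
  have "(\<forall>w. g w = 0) \<longleftrightarrow> g = (\<lambda>_. 0)" by auto
  then show ?case by (simp add: flow_def indeg_def outdeg_def)
next
  case (Cons a as)
  obtain u v where a: "a = (u, v)" by (cases a)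
  have uv: "u \<noteq> v" "(u, v) \<notin> set as" using Cons.prems a by auto
  let ?g = "\<lambda>w. g w - int (outdeg (set (a # as)) w)"
  note out = outdeg_insert[OF finite_set uv(2)]
  have 1: "(\<lambda>w. (g(u := g u - 1)) w - int (outdeg (set as) w)) = ?g"
    using uv by (auto simp: a out)
  have 2: "(\<lambda>w. (g(v := g v - 1)) w - int (outdeg (set as) w)) = ?g(u := ?g u + 1, v := ?g v - 1)"
    using uv by (auto simp: a out)
  have IH: "coef as h = flow (set as) (\<lambda>w. h w - int (outdeg (set as) w))" for h
    using Cons by auto
  have "coef (a # as) g = flow (set as) ?g - flow (set as) (?g(u := ?g u + 1, v := ?g v - 1))"
    unfolding a coef.simps IH using 1 2 unfolding a by metis
  also have "\<dots> = flow (set (a # as)) ?g"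
    using flow_insert[OF finite_set uv(2,1), of ?g] by (simp only: a list.set)
  finally show ?case .
qed

text \<open>Reversing an arc negates one factor, so up to a global sign the coefficients depend on
  the edges alone.\<close>

lemma coef_flip:
  assumes "map edge as' = map edge as"
  shows "\<exists>s\<in>{1, -1}. \<forall>g. coef as' g = s * coef as g"
  using assms
proof (induction as arbitrary: as')
  case Nil
  then show ?case by auto
next
  case (Cons a as)
  then obtain a' bs where as': "as' = a' # bs" "edge a' = edge a" "map edge bs = map edge as" by auto
  obtain s where s: "s \<in> {1, -1}" "\<And>g. coef bs g = s * coef as g" using Cons.IH[OF as'(3)] by blast
  obtain u v where a: "a = (u, v)" by (cases a)
  obtain u' v' where a': "a' = (u', v')" by (cases a')
  have "(u' = u \<and> v' = v) \<or> (u' = v \<and> v' = u)" using as'(2) a a' by (auto simp: doubleton_eq_iff)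
  then show ?case
  proof
    assume "u' = u \<and> v' = v"
    then show ?thesis using s by (intro bexI[of _ s]) (auto simp: as' a a' algebra_simps)
  next
    assume "u' = v \<and> v' = u"
    then show ?thesis using s by (intro bexI[of _ "- s"]) (auto simp: as' a a' algebra_simps)
  qed
qed

lemma outdeg_set:
  assumes "distinct as"
  shows "outdeg (set as) w = length (filter (\<lambda>a. fst a = w) as)"
  using assms
proof (induction as)
  case (Cons a as)
  then show ?case using outdeg_insert[of "set as" "fst a" "snd a" w] by auto
qed (simp add: outdeg_def)

text \<open>A nonzero coefficient needs a contributing term, that is, a choice of one end of each
  edge; making the chosen ends the tails gives out-degrees \<open>g\<close>.\<close>

lemma coef_realize:
  assumes "coef as g \<noteq> 0"
  shows "\<exists>as'. map edge as' = map edge as \<and> (\<forall>w. g w = int (length (filter (\<lambda>a. fst a = w) as')))"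
  using assms
proof (induction as arbitrary: g)
  case Nil
  then show ?case by (auto split: if_splits)
next
  case (Cons a as)
  obtain u v where a: "a = (u, v)" by (cases a)
  consider "coef as (g(u := g u - 1)) \<noteq> 0" | "coef as (g(v := g v - 1)) \<noteq> 0"
    using Cons.prems a by fastforce
  then show ?case
  proof cases
    case 1
    from Cons.IH[OF this] obtain bs where bs: "map edge bs = map edge as"
      "\<And>w. (g(u := g u - 1)) w = int (length (filter (\<lambda>a. fst a = w) bs))" by blast
    have "g w = int (length (filter (\<lambda>a. fst a = w) ((u, v) # bs)))" for w
      using bs(2)[of w] by (auto split: if_splits)
    then show ?thesis using bs(1) a by (intro exI[of _ "(u, v) # bs"]) auto
  next
    case 2
    from Cons.IH[OF this] obtain bs where bs: "map edge bs = map edge as"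
      "\<And>w. (g(v := g v - 1)) w = int (length (filter (\<lambda>a. fst a = w) bs))" by blast
    have "g w = int (length (filter (\<lambda>a. fst a = w) ((v, u) # bs)))" for w
      using bs(2)[of w] by (auto split: if_splits)
    then show ?thesis using bs(1) a by (intro exI[of _ "(v, u) # bs"]) auto
  qed
qed

text \<open>\<open>flow\<close> tests balance at every vertex of the type, \<open>diff\<close> only
  on \<open>V\<close>; outside \<open>V\<close> both degrees are 0.\<close>

lemma flow_zero_eq_diff:
  assumes "finite D" "D \<subseteq> V \<times> V"
  shows "flow D (\<lambda>_. 0) = diff V D"
proof -
  have eu: "eulerian_sub V D F \<longleftrightarrow> F \<in> Pow D \<and> (\<forall>w. int (indeg F w) - int (outdeg F w) = 0)" for F
  proof -
    have "outdeg F w = indeg F w" if "F \<subseteq> D" "w \<notin> V" for w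
    proof -
      have "{z. (w, z) \<in> F} = {}" "{z. (z, w) \<in> F} = {}" using that assms by auto
      then show ?thesis by (simp only: outdeg_def indeg_def)
    qed
    then have "(\<forall>w\<in>V. outdeg F w = indeg F w) \<longleftrightarrow> (\<forall>w. indeg F w = outdeg F w)" if "F \<subseteq> D"
      using that by metis
    then show ?thesis unfolding eulerian_sub_def by auto
  qed
  let ?X = "{F. eulerian_sub V D F}"
  have fin: "finite ?X" using assms(1) by (auto simp: eulerian_sub_def)
  have "flow D (\<lambda>_. 0) = (\<Sum>F\<in>?X. (-1) ^ card F)"
    unfolding flow_def using assms(1) by (subst sum.inter_filter[symmetric]) (auto simp: eu intro!: sum.cong)
  also have "\<dots> = (\<Sum>F\<in>{F\<in>?X. even (card F)} \<union> {F\<in>?X. odd (card F)}. (-1) ^ card F)"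
    by (intro sum.cong) auto
  also have "\<dots> = (\<Sum>F\<in>{F\<in>?X. even (card F)}. (-1) ^ card F) + (\<Sum>F\<in>{F\<in>?X. odd (card F)}. (-1) ^ card F)"
    using fin by (intro sum.union_disjoint) auto
  also have "\<dots> = diff V D"
    by (simp add: diff_def)
  finally show ?thesis .
qed

text \<open>Distinctness of \<open>map edge as\<close> makes the list carry one arc per edge. Its
  directions are arbitrary, as they only affect the sign.\<close>

definition poly_AT :: "'a set \<Rightarrow> 'a set set \<Rightarrow> ('a \<Rightarrow> nat) \<Rightarrow> bool" where
  "poly_AT V E f \<longleftrightarrow> (\<exists>as g. distinct (map edge as) \<and> edge ` set as = E \<and> coef as g \<noteq> 0 \<and>
     (\<forall>v\<in>V. g v < int (f v)))"

text \<open>The Alon-Tarsi argument: for an orientation realising \<open>g\<close>, the imbalance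
  \<open>g\<close> minus out-degree vanishes, so the coefficient at \<open>g\<close> is
  \<open>diff\<close> up to sign.\<close>

lemma f_AT_if_poly_AT:
  assumes G: "simple_graph V E" and P: "poly_AT V E f"
  shows "f_AT V E f"
proof -
  obtain as g where as: "distinct (map edge as)" "edge ` set as = E" "coef as g \<noteq> 0"
    and g: "\<forall>v\<in>V. g v < int (f v)"
    using P unfolding poly_AT_def by blast
  obtain bs where bs: "map edge bs = map edge as"
    "\<And>w. g w = int (length (filter (\<lambda>a. fst a = w) bs))" using coef_realize[OF as(3)] by blast
  have dist: "distinct (map edge bs)" using bs as by simp
  then have db: "distinct bs" by (simp add: distinct_map)
  have img: "edge ` set bs = E" using bs as by (metis list.set_map)
  then have E: "{fst a, snd a} \<in> E" if "a \<in> set bs" for a using that by (auto simp: edge_def)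
  have ne: "\<forall>(u, v)\<in>set bs. u \<noteq> v" using E G by (force simp: simple_graph_def)
  have sub: "set bs \<subseteq> V \<times> V" using E G by (force simp: simple_graph_def)
  have out: "int (outdeg (set bs) w) = g w" for w using outdeg_set[OF db] bs(2) by simp
  have "coef bs g \<noteq> 0" using coef_flip[OF bs(1)] as(3) by auto
  then have "diff V (set bs) \<noteq> 0"
    using coef_eq_flow[OF db ne, of g] flow_zero_eq_diff[OF _ sub] by (simp add: out)
  moreover have "is_orientation E (set bs)"
    unfolding is_orientation_def
  proof (intro conjI ballI)
    show "case a of (u, v) \<Rightarrow> {u, v} \<in> E" if "a \<in> set bs" for a using E[OF that] by (cases a) auto
    show "\<exists>!a. a \<in> set bs \<and> {fst a, snd a} = e" if "e \<in> E" for e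
    proof -
      obtain a where "a \<in> set bs" "edge a = e" using \<open>e \<in> E\<close> img by auto
      moreover have "inj_on edge (set bs)" using dist by (simp add: distinct_map)
      ultimately show ?thesis unfolding edge_def[symmetric] by (metis inj_onD)
    qed
  qed
  ultimately show ?thesis
    unfolding f_AT_def AT_orientation_def using g out by (intro exI[of _ "set bs"]) force
qed

section \<open>Exponents forced by incidence\<close>

lemma coef_bounds:
  assumes "coef as g \<noteq> 0"
  shows "0 \<le> g w" "g w \<le> int (length (filter (\<lambda>a. w \<in> edge a) as))"
  using assms
proof (induction as arbitrary: g)
  case (Cons a as)
  obtain u v where a: "a = (u, v)" by (cases a)
  {
    case 1
    then consider "coef as (g(u := g u - 1)) \<noteq> 0" | "coef as (g(v := g v - 1)) \<noteq> 0"
      using a by fastforce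
    then show ?case by cases (use Cons.IH(1) in \<open>fastforce split: if_splits\<close>)+
  next
    case 2
    then consider "coef as (g(u := g u - 1)) \<noteq> 0" | "coef as (g(v := g v - 1)) \<noteq> 0"
      using a by fastforce
    then show ?case by cases (use Cons.IH(2) a in \<open>fastforce split: if_splits\<close>)+
  }
qed (auto split: if_splits)

lemma coef_eq_0:
  assumes "\<And>a. a \<in> set as \<Longrightarrow> w \<notin> edge a" "g w \<noteq> 0"
  shows "coef as g = 0"
proof (rule ccontr)
  assume "coef as g \<noteq> 0"
  from coef_bounds[OF this, of w] have "g w \<le> int (length (filter (\<lambda>a. w \<in> edge a) as))" "0 \<le> g w"
    by auto
  moreover have "filter (\<lambda>a. w \<in> edge a) as = []" using assms(1) by (auto simp: filter_empty_conv)
  ultimately show False using assms(2) by simp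
qed

text \<open>The exponent of \<open>v\<close> equals the number of factors containing
  \<open>v\<close>, so each of them has to contribute \<open>v\<close>.\<close>

lemma coef_source:
  assumes "\<And>a. a \<in> set as \<Longrightarrow> v \<notin> edge a" "v \<notin> set ws" "g v = int (length ws)"
  shows "coef (map (Pair v) ws @ as) g = coef as (g(v := 0))"
  using assms(2,3)
proof (induction ws arbitrary: g)
  case Nil
  then show ?case by (metis append_Nil fun_upd_triv list.map(1) list.size(3) of_nat_0)
next
  case (Cons w ws)
  \<comment> \<open>If the first arc contributed \<open>w\<close>, the remaining arcs would have to
    supply one more \<open>v\<close> than they contain.\<close>
  have "length (filter (\<lambda>a. v \<in> edge a) (map (Pair v) ws @ as)) \<le> length ws"
    using assms(1) by (simp add: filter_empty_conv)
  moreover have "(g(w := g w - 1)) v = int (length ws) + 1" using Cons by auto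
  ultimately have "coef (map (Pair v) ws @ as) (g(w := g w - 1)) = 0"
    using coef_bounds(2)[of "map (Pair v) ws @ as" "g(w := g w - 1)" v] by fastforce
  moreover have "(g(v := g v - 1))(v := 0) = g(v := 0)" by simp
  moreover have "coef (map (Pair v) ws @ as) (g(v := g v - 1)) = coef as ((g(v := g v - 1))(v := 0))"
    using Cons by (intro Cons.IH) auto
  ultimately show ?case by (simp del: fun_upd_apply)
qed

section \<open>Reductions\<close>

lemma edges_at:
  assumes "simple_graph V E"
  shows "E = (\<lambda>w. {v, w}) ` nb E v \<union> del E {v}"
proof (intro equalityI subsetI)
  fix e assume e: "e \<in> E"
  show "e \<in> (\<lambda>w. {v, w}) ` nb E v \<union> del E {v}"
  proof (cases "v \<in> e")
    case True
    obtain p q where "e = {p, q}" using assms e by (auto simp: simple_graph_def card_2_iff)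
    then show ?thesis using True e by (auto simp: nb_def insert_commute)
  qed (use e in \<open>auto simp: del_def\<close>)
qed (auto simp: nb_def del_def)

lemma coef_support:
  assumes "edge ` set as \<subseteq> del E X" "w \<in> X" "g w \<noteq> 0"
  shows "coef as g = 0"
  using assms by (intro coef_eq_0[of as w]) (auto simp: del_def)

lemma poly_AT_mono:
  assumes "poly_AT V E f" "\<And>v. v \<in> V \<Longrightarrow> f v \<le> f' v"
  shows "poly_AT V E f'"
proof -
  obtain as g where as: "distinct (map edge as)" "edge ` set as = E" "coef as g \<noteq> 0"
    and g: "\<forall>v\<in>V. g v < int (f v)"
    using assms(1) unfolding poly_AT_def by blast
  have "\<forall>v\<in>V. g v < int (f' v)" using g assms(2) by fastforce
  then show ?thesis using as unfolding poly_AT_def by blast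
qed

lemma poly_AT_source:
  assumes G: "simple_graph V E" and v: "card (nb E v) < f v"
    and P: "poly_AT (V - {v}) (del E {v}) f"
  shows "poly_AT V E f"
proof -
  obtain as g where as: "distinct (map edge as)" "edge ` set as = del E {v}" "coef as g \<noteq> 0"
    and g: "\<forall>u\<in>V - {v}. g u < int (f u)"
    using P unfolding poly_AT_def by blast
  obtain ws where ws: "set ws = nb E v" "distinct ws"
    using finite_distinct_list[OF finite_nb[OF G]] by blast
  have len: "length ws = card (nb E v)" using ws distinct_card by metis
  let ?as = "map (Pair v) ws @ as"
  let ?g = "g(v := int (length ws))"
  \<comment> \<open>No arc of \<open>as\<close> touches \<open>v\<close>, so a nonzero coefficient
    forces exponent 0 there, and resetting \<open>?g\<close> at \<open>v\<close> gives back
    \<open>g\<close>.\<close>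
  have gv: "g v = 0" using coef_support[of as E "{v}" v g] as by auto
  have notin: "v \<notin> edge a" if "a \<in> set as" for a using that as(2) by (auto simp: del_def)
  have "v \<notin> set ws" using ws not_self_nb[OF G] by simp
  then have "coef ?as ?g = coef as (?g(v := 0))" by (intro coef_source notin) auto
  also have "?g(v := 0) = g" using gv by auto
  finally have "coef ?as ?g = coef as g" .
  then have "coef ?as ?g \<noteq> 0" using as(3) by metis
  moreover have "edge ` set ?as = E"
    using edges_at[OF G, of v] as(2) ws(1) by (auto simp: image_Un image_image)
  moreover have "distinct (map edge ?as)"
    using ws(2) as(1) notin by (auto simp: distinct_map inj_on_def doubleton_eq_iff)
  moreover have "\<forall>u\<in>V. ?g u < int (f u)" using g v len by auto
  ultimately show ?thesis unfolding poly_AT_def by blast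
qed

text \<open>Vertices of degree at most 2 other than \<open>y\<close> are removed as sources until at
  most \<open>y\<close> is left, with exponent 0.\<close>

lemma poly_AT_degenerate:
  assumes "simple_graph V E" "\<not> has_K4_minor V E" "1 \<le> f y" "\<And>v. v \<noteq> y \<Longrightarrow> 3 \<le> f v"
  shows "poly_AT V E f"
  using assms(1,2)
proof (induction "card V" arbitrary: V E rule: less_induct)
  case less
  note G = less.prems(1) and K = less.prems(2)
  show ?case
  proof (cases "V \<subseteq> {y}")
    case True
    have "e \<notin> E" for e
    proof
      assume "e \<in> E"
      then have "e \<subseteq> {y}" "card e = 2" using G True by (auto simp: simple_graph_def)
      then show False using card_mono[of "{y}" e] by simp
    qed
    then have "E = {}" by blast
    moreover have "0 < f v" for v using assms(3) assms(4)[of v] by (cases "v = y") auto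
    ultimately show ?thesis
      unfolding poly_AT_def by (intro exI[of _ "[]"] exI[of _ "\<lambda>_. 0"]) auto
  next
    case False
    then obtain u where "u \<in> V" "u \<noteq> y" by blast
    then obtain v where v: "v \<in> V" "v \<noteq> y" "card (nb E v) \<le> 2"
      using low_degree_vertex[OF G K] by blast
    have "card (V - {v}) < card V" using v G by (metis card_Diff1_less simple_graph_def)
    then have "poly_AT (V - {v}) (del E {v}) f"
      using less.hyps simple_graph_del[OF G] no_K4_minor_del[OF K] by blast
    then show ?thesis using v(3) assms(4)[OF v(2)] by (intro poly_AT_source[OF G, of v]) auto
  qed
qed

text \<open>In (x-a)(x-b)(a-b)(a-d) the part linear in x is -(a+b)(a-b)(a-d) = -(a^2-b^2)(a-d),
  whose coefficient at a^2 is d: the terms in b cancel. The remaining factors contain neither x nor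
  a.\<close>

lemma coef_diamond:
  assumes d: "distinct [x, a, b, d]"
    and Z: "\<And>h. h x \<noteq> 0 \<Longrightarrow> coef as h = 0" "\<And>h. h a \<noteq> 0 \<Longrightarrow> coef as h = 0"
    and g: "g x = 0" "g a = 0"
  shows "coef ((x, a) # (x, b) # (a, b) # (a, d) # as) (g(x := 1, a := 2, d := g d + 1)) = coef as g"
proof -
  have "x \<noteq> a" "x \<noteq> b" "x \<noteq> d" "a \<noteq> b" "a \<noteq> d" "b \<noteq> d" using d by auto
  note ne = this this[symmetric]
  show ?thesis by (simp add: Z ne g fun_upd_idem)
qed

text \<open>As for the diamond, the first four factors contribute d, which is free of b; the
  exponent 1 at b then selects b from the new factor b-e.\<close>

lemma coef_square:
  assumes d: "distinct [x, a, b, d]" "distinct [x, a, b, e]"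
    and Z: "\<And>h. h x \<noteq> 0 \<Longrightarrow> coef as h = 0" "\<And>h. h a \<noteq> 0 \<Longrightarrow> coef as h = 0"
      "\<And>h. h b \<noteq> 0 \<Longrightarrow> coef as h = 0"
    and g: "g x = 0" "g a = 0" "g b = 0"
  shows "coef ((x, a) # (x, b) # (a, b) # (a, d) # (b, e) # as)
           (g(x := 1, a := 2, b := 1, d := g d + 1)) = coef as g"
proof -
  have "x \<noteq> a" "x \<noteq> b" "x \<noteq> d" "a \<noteq> b" "a \<noteq> d" "b \<noteq> d" "x \<noteq> e" "a \<noteq> e" "b \<noteq> e"
    using d by auto
  note ne = this this[symmetric]
  show ?thesis by (simp add: Z ne g fun_upd_idem)
qed


lemma poly_AT_diamond:
  assumes G: "simple_graph V E" and d: "distinct [x, a, b, d]"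
    and nx: "nb E x = {a, b}" and na: "nb E a = {x, b, d}"
    and P: "poly_AT (V - {x, a}) (del E {x, a}) f'"
    and f: "2 \<le> f x" "3 \<le> f a" "\<And>v. v \<in> V - {x, a} \<Longrightarrow> f' v + (if v = d then 1 else 0) \<le> f v"
  shows "poly_AT V E f"
proof -
  obtain as g where as: "distinct (map edge as)" "edge ` set as = del E {x, a}" "coef as g \<noteq> 0"
    and g: "\<forall>v\<in>V - {x, a}. g v < int (f' v)"
    using P unfolding poly_AT_def by blast
  have Z: "coef as h = 0" if "h x \<noteq> 0 \<or> h a \<noteq> 0" for h
    using that coef_support[of as E "{x, a}"] as(2) by auto
  let ?as = "(x, a) # (x, b) # (a, b) # (a, d) # as"
  let ?g = "g(x := 1, a := 2, d := g d + 1)"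
  have "coef ?as ?g = coef as g" using Z as(3) by (intro coef_diamond d) auto
  then have "coef ?as ?g \<noteq> 0" using as(3) by metis
  moreover have "edge ` set ?as = E"
  proof -
    have "nb (del E {x}) a = {b, d}" using d na by (auto simp: nb_del)
    then have "E = {{x, a}, {x, b}} \<union> ({{a, b}, {a, d}} \<union> del E {x, a})"
      using edges_at[OF G, of x] edges_at[OF simple_graph_del[OF G, of "{x}"], of a] nx
      by (simp add: del_del insert_commute)
    then show ?thesis using as(2) by auto
  qed
  moreover have "distinct (map edge ?as)"
  proof -
    have "edge p \<in> del E {x, a}" if "p \<in> set as" for p using that as(2) by auto
    then have "edge p \<inter> {x, a} = {}" if "p \<in> set as" for p using that by (auto simp: del_def)
    then show ?thesis using as(1) d by (auto simp: doubleton_eq_iff)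
  qed
  moreover have "\<forall>v\<in>V. ?g v < int (f v)"
  proof
    fix v assume v: "v \<in> V"
    show "?g v < int (f v)"
    proof (cases "v = x \<or> v = a")
      case True
      then show ?thesis using f d by auto
    next
      case False
      then have "?g v = g v + int (if v = d then 1 else 0)" by simp
      also have "\<dots> < int (f' v) + int (if v = d then 1 else 0)" using False g v by simp
      also have "\<dots> \<le> int (f v)" using False f(3)[of v] v by (metis Diff_iff empty_iff insert_iff of_nat_add of_nat_mono)
      finally show ?thesis .
    qed
  qed
  ultimately show ?thesis unfolding poly_AT_def by blast
qed

text \<open>Only \<open>d\<close> pays for the removal. Exchanging \<open>a\<close> with
  \<open>b\<close> and \<open>d\<close> with \<open>e\<close> lets \<open>e\<close> pay
  instead.\<close>

lemma poly_AT_square: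
  assumes G: "simple_graph V E" and d: "distinct [x, a, b, d]" "distinct [x, a, b, e]"
    and nx: "nb E x = {a, b}" and na: "nb E a = {x, b, d}" and nb: "nb E b = {x, a, e}"
    and P: "poly_AT (V - {x, a, b}) (del E {x, a, b}) f'"
    and f: "2 \<le> f x" "3 \<le> f a" "2 \<le> f b"
      "\<And>v. v \<in> V - {x, a, b} \<Longrightarrow> f' v + (if v = d then 1 else 0) \<le> f v"
  shows "poly_AT V E f"
proof -
  obtain as g where as: "distinct (map edge as)" "edge ` set as = del E {x, a, b}" "coef as g \<noteq> 0"
    and g: "\<forall>v\<in>V - {x, a, b}. g v < int (f' v)"
    using P unfolding poly_AT_def by blast
  have Z: "coef as h = 0" if "h x \<noteq> 0 \<or> h a \<noteq> 0 \<or> h b \<noteq> 0" for h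
    using that coef_support[of as E "{x, a, b}"] as(2) by auto
  let ?as = "(x, a) # (x, b) # (a, b) # (a, d) # (b, e) # as"
  let ?g = "g(x := 1, a := 2, b := 1, d := g d + 1)"
  have "coef ?as ?g = coef as g" using Z as(3) by (intro coef_square d) auto
  then have "coef ?as ?g \<noteq> 0" using as(3) by metis
  moreover have "edge ` set ?as = E"
  proof -
    have "nb (del E {x}) a = {b, d}" "nb (del E {x, a}) b = {e}" using d na nb by (auto simp: nb_del)
    then have "E = {{x, a}, {x, b}} \<union> ({{a, b}, {a, d}} \<union> ({{b, e}} \<union> del E {x, a, b}))"
      using edges_at[OF G, of x] edges_at[OF simple_graph_del[OF G, of "{x}"], of a]
        edges_at[OF simple_graph_del[OF G, of "{x, a}"], of b] nx
      by (simp add: del_del insert_commute)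
    then show ?thesis using as(2) by auto
  qed
  moreover have "distinct (map edge ?as)"
  proof -
    have "edge p \<in> del E {x, a, b}" if "p \<in> set as" for p using that as(2) by auto
    then have "edge p \<inter> {x, a, b} = {}" if "p \<in> set as" for p using that by (auto simp: del_def)
    then show ?thesis using as(1) d by (auto simp: doubleton_eq_iff)
  qed
  moreover have "\<forall>v\<in>V. ?g v < int (f v)"
  proof
    fix v assume v: "v \<in> V"
    show "?g v < int (f v)"
    proof (cases "v = x \<or> v = a \<or> v = b")
      case True
      then show ?thesis using f d by auto
    next
      case False
      then have "?g v = g v + int (if v = d then 1 else 0)" by simp
      also have "\<dots> < int (f' v) + int (if v = d then 1 else 0)" using False g v by simp
      also have "\<dots> \<le> int (f v)" using False f(4)[of v] v by (metis Diff_iff empty_iff insert_iff of_nat_add of_nat_mono)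
      finally show ?thesis .
    qed
  qed
  ultimately show ?thesis unfolding poly_AT_def by blast
qed

section \<open>Extending from two vertices\<close>

text \<open>Both values of \<open>t\<close> share one induction, in which \<open>y\<close> stays
  fixed while the other root \<open>x\<close> may move. The chain condition is stated by
  \<open>dia\<close> because it then passes to subgraphs.\<close>

lemma poly_AT_two_roots:
  assumes "simple_graph V E" "\<not> has_K4_minor V E" "x \<in> V" "y \<in> V" "x \<noteq> y"
    and "t = 2 \<or> t = 1 \<and> (x, y) \<notin> (dia E)\<^sup>*"
  shows "poly_AT V E (\<lambda>v. if v = x then 2 else if v = y then t else 3)"
  using assms
proof (induction "card V" arbitrary: V E x rule: less_induct)
  case less
  note G = less.prems(1) and K = less.prems(2) and xV = less.prems(3) and yV = less.prems(4)
    and xy = less.prems(5) and t = less.prems(6)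
  let ?f = "\<lambda>v. if v = x then 2 else if v = y then t else 3 :: nat"
  \<comment> \<open>\<open>X\<close> is the removed set and \<open>z\<close> the new root;
    \<open>v\<close> only helps to witness that \<open>X\<close> meets \<open>V\<close>.\<close>
  have IH: "poly_AT (V - X) (del E X) (\<lambda>v. if v = z then 2 else if v = y then t else 3)"
    if "x \<in> X \<or> v \<in> X" "v \<in> V" "z \<in> V - X" "y \<notin> X" "z \<noteq> y"
      "t = 2 \<or> t = 1 \<and> (z, y) \<notin> (dia (del E X))\<^sup>*" for X v z
  proof (rule less.hyps)
    have "V - X \<subset> V" using that xV by blast
    then show "card (V - X) < card V" using G by (simp add: psubset_card_mono simple_graph_def)
  qed (use that yV simple_graph_del[OF G] no_K4_minor_del[OF K] in auto)
  have dia_del: "(p, q) \<in> (dia E)\<^sup>*" if "(p, q) \<in> (dia (del E X))\<^sup>*" for p q X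
    using that rtrancl_mono[OF dia_mono[OF del_subset]] by blast
  have degen: "poly_AT (V - X) (del E X) (\<lambda>v. if v = y then 1 else 3)" for X
    by (rule poly_AT_degenerate[OF simple_graph_del[OF G] no_K4_minor_del[OF K], of _ y]) auto
  have t1: "1 \<le> t" using t by auto
  show ?case
  proof (cases "\<exists>v\<in>V. v \<noteq> x \<and> v \<noteq> y \<and> card (nb E v) \<le> 2")
    case True
    then obtain v where v: "v \<in> V" "v \<noteq> x" "v \<noteq> y" "card (nb E v) \<le> 2" by blast
    have "poly_AT (V - {v}) (del E {v}) ?f"
      by (rule IH[of _ v]) (use v xV xy t dia_del in auto)
    then show ?thesis using v by (intro poly_AT_source[OF G, of v]) auto
  next
    case False
    then have deg: "3 \<le> card (nb E v)" if "v \<in> V" "v \<noteq> x" "v \<noteq> y" for v using that by force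
    have fin: "finite (nb E v)" for v using finite_nb[OF G] .
    \<comment> \<open>With \<open>y\<close> exempt, the promised vertex of low degree can only be
      \<open>x\<close>.\<close>
    obtain l where "l \<in> V" "l \<noteq> y" "card (nb E l) \<le> 2"
      using low_degree_vertex[OF G K xV xy] by blast
    then have "card (nb E x) \<le> 2" using deg[of l] by (cases "l = x") auto
    show ?thesis
    proof (cases "card (nb E x) = 2")
      case False
      \<comment> \<open>x has degree at most 1 and is a source; after its removal only y is restricted.\<close>
      have "poly_AT (V - {x}) (del E {x}) ?f"
        by (rule poly_AT_mono[OF degen]) (use t1 in auto)
      then show ?thesis
        using \<open>card (nb E x) \<le> 2\<close> False by (intro poly_AT_source[OF G, of x]) auto
    next
      case True
      then obtain p q where pq: "nb E x = {p, q}" "p \<noteq> q" by (auto simp: card_2_iff)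
      have pqE: "{p, q} \<in> E"
        using degree_two_nbs_adjacent[OF G K pq, of y] deg by blast
      have pqV: "p \<in> V" "q \<in> V" "p \<noteq> x" "q \<noteq> x"
        using nb_subset[OF G, of x] not_self_nb[OF G, of x] pq by auto
      let ?V1 = "V - {x}" and ?E1 = "del E {x}"
      note G1 = simple_graph_del[OF G, of "{x}"] and K1 = no_K4_minor_del[OF K, of "{x}"]
      have nb1: "nb ?E1 w = nb E w - {x}" if "w \<noteq> x" for w using that by (simp add: nb_del)
      have deg1: "3 \<le> card (nb ?E1 w)" if "w \<in> ?V1" "w \<noteq> y" "w \<noteq> p" "w \<noteq> q" for w
      proof -
        have "x \<notin> nb E w" using that(3,4) pq(1) in_nb_commute[of x E w] by simp
        then show ?thesis using that deg[of w] nb1[of w] by simp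
      qed
      obtain u where "u \<in> ?V1" "u \<noteq> y" using pqV pq(2) by blast
      then obtain a where a: "a \<in> ?V1" "a \<noteq> y" "card (nb ?E1 a) \<le> 2"
        using low_degree_vertex[OF G1 K1] by blast
      \<comment> \<open>Removing \<open>x\<close> lowers the degrees of \<open>p\<close> and
        \<open>q\<close> only, so the low vertex of the smaller graph is one of them; the names
        \<open>a\<close>, \<open>b\<close> record which.\<close>
      then have "a = p \<or> a = q" using deg1[of a] by force
      then obtain b where ab: "nb E x = {a, b}" "a \<noteq> b" "{a, b} \<in> E"
        using pq pqE by (metis insert_commute)
      have abV: "a \<in> V" "b \<in> V" "a \<noteq> x" "b \<noteq> x"
        using nb_subset[OF G, of x] not_self_nb[OF G, of x] ab by auto
      have third: "\<exists>d. nb E v = {x, w, d} \<and> d \<noteq> x \<and> d \<noteq> w \<and> d \<noteq> v"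
        if v: "{v, w} = {a, b}" "v \<noteq> y" "card (nb ?E1 v) \<le> 2" for v w
      proof -
        have vV: "v \<in> V" "v \<noteq> x" "w \<noteq> x" and xv: "x \<in> nb E v" and wv: "w \<in> nb E v"
          using v(1) abV ab in_nb_commute[of x E v] by (auto simp: doubleton_eq_iff nb_def insert_commute)
        have "card (nb E v) = Suc (card (nb ?E1 v))"
          using xv fin nb1[OF vV(2)] by (metis card.remove)
        then have "card (nb ?E1 v) = 2" using v(3) deg[of v] vV v(2) by simp
        moreover have "w \<in> nb ?E1 v" using wv vV nb1 by simp
        ultimately obtain d where d: "nb ?E1 v = {w, d}" "d \<noteq> w"
          by (metis card_2_iff doubleton_eq_iff insertE singletonD)
        then have "nb E v = {x, w, d}" using nb1[OF vV(2)] xv by auto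
        moreover have "d \<noteq> x" using d nb1[OF vV(2)] by auto
        moreover have "d \<noteq> v" using calculation(1) not_self_nb[OF G, of v] by auto
        ultimately show ?thesis using d by blast
      qed
      obtain d where na: "nb E a = {x, b, d}" and d: "d \<noteq> x" "d \<noteq> b" "d \<noteq> a"
        using third[of a b] a by blast
      have dV: "d \<in> V" using nb_subset[OF G, of a] na by auto
      have dist: "distinct [x, a, b, d]" using d ab abV by auto
      have na1: "nb ?E1 a = {b, d}" using nb1[of a] na abV d by auto
      show ?thesis
      proof (cases "{b, d} \<in> E")
        case True
        have "{x, a} \<in> E" "{x, b} \<in> E" "{a, d} \<in> E" using ab na by (auto simp: nb_def)
        then have xd: "(x, d) \<in> dia E" using ab(3) True by (auto simp: dia_def)
        show ?thesis
        proof (cases "d = y")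
          case True
          \<comment> \<open>The diamond itself links \<open>x\<close> to \<open>y\<close>, which
            excludes \<open>t = 1\<close>. Charging \<open>y\<close> one unit leaves it 1, which is
            what \<open>degen\<close> provides.\<close>
          then have "t = 2" using t xd by auto
          then show ?thesis
            by (intro poly_AT_diamond[OF G dist ab(1) na degen]) (use True a abV in auto)
        next
          case False
          \<comment> \<open>A chain from \<open>d\<close> to \<open>y\<close> would extend through
            the present diamond to one from \<open>x\<close>.\<close>
          have "t = 2 \<or> t = 1 \<and> (d, y) \<notin> (dia (del E {x, a}))\<^sup>*"
            using t dia_del xd by (meson converse_rtrancl_into_rtrancl)
          then have "poly_AT (V - {x, a}) (del E {x, a}) (\<lambda>v. if v = d then 2 else if v = y then t else 3)"
            by (intro IH[of _ x]) (use False d dV xV xy a in auto)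
          then show ?thesis
            by (intro poly_AT_diamond[OF G dist ab(1) na]) (use False a abV in auto)
        qed
      next
        case bd: False
        then have bd1: "{b, d} \<notin> ?E1" using del_subset by blast
        \<comment> \<open>Otherwise \<open>a\<close> would be the only vertex besides
          \<open>y\<close> of degree below 3 after removing \<open>x\<close>, and its neighbours
          \<open>b\<close> and \<open>d\<close> would be adjacent.\<close>
        have low_b: "b \<noteq> y \<and> card (nb ?E1 b) \<le> 2"
        proof (rule ccontr)
          assume b: "\<not> ?thesis"
          have "3 \<le> card (nb ?E1 w)" if "w \<in> ?V1" "w \<noteq> a" "w \<noteq> y" for w
            using that b deg1[of w] ab(1) pq(1) by (cases "w = b") (auto simp: doubleton_eq_iff)
          then have "{b, d} \<in> ?E1"
            using degree_two_nbs_adjacent[OF G1 K1 na1] d by blast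
          then show False using bd1 by blast
        qed
        then obtain e where nb: "nb E b = {x, a, e}" and e: "e \<noteq> x" "e \<noteq> a" "e \<noteq> b"
          using third[of b a] ab by blast
        have eV: "e \<in> V" using nb_subset[OF G, of b] nb by auto
        have de: "d \<noteq> e" using bd nb by (auto simp: nb_def)
        \<comment> \<open>Suppressing \<open>a\<close> after removing \<open>x\<close> leaves
          \<open>b\<close> with the two neighbours \<open>d\<close> and \<open>e\<close>. These must
          be adjacent, and since \<open>{d, e}\<close> is not the added edge it belongs to the
          original graph.\<close>
        let ?E2 = "insert {b, d} (del ?E1 {a})"
        note s = suppress[OF G1 K1 na1 d(2)[symmetric] bd1]
        have "nb ?E2 b = {d, e}" using s(3)[of b] nb1[of b] nb abV ab(2) e d by auto
        moreover have "3 \<le> card (nb ?E2 w)" if "w \<in> ?V1 - {a}" "w \<noteq> b" "w \<noteq> y" for w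
        proof -
          have "w \<noteq> p" "w \<noteq> q" using that ab(1) pq(1) by (auto simp: doubleton_eq_iff)
          then show ?thesis using s(4)[of w] deg1[of w] that by auto
        qed
        ultimately have "{d, e} \<in> ?E2"
          using degree_two_nbs_adjacent[OF s(1,2) _ de] by blast
        then have deE: "{d, e} \<in> del E {x, a, b}"
          using d e de by (auto simp: del_def doubleton_eq_iff)
        let ?H = "del E {x, a, b}"
        obtain c :: "'a \<Rightarrow> nat" where c: "\<And>v. c v < 3" "\<And>p q. {p, q} \<in> ?H \<Longrightarrow> c p \<noteq> c q"
          using three_colouring[OF simple_graph_del[OF G] no_K4_minor_del[OF K]] by metis
        have "(d, y) \<notin> (dia ?H)\<^sup>* \<or> (e, y) \<notin> (dia ?H)\<^sup>*"
          using dia_same_colour[of _ y ?H c] c deE by metis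
        \<comment> \<open>For \<open>t = 2\<close> one of the distinct \<open>d\<close>,
          \<open>e\<close> differs from \<open>y\<close>; for \<open>t = 1\<close> reflexivity of
          the closure excludes \<open>z = y\<close>.\<close>
        then obtain z where z: "z = d \<or> z = e" "z \<noteq> y"
          and tz: "t = 2 \<or> t = 1 \<and> (z, y) \<notin> (dia ?H)\<^sup>*"
          using t de by (metis rtrancl.rtrancl_refl)
        have P: "poly_AT (V - {x, a, b}) ?H (\<lambda>v. if v = z then 2 else if v = y then t else 3)"
          using tz by (intro IH[of _ x]) (use z d e dV eV xV xy a low_b in auto)
        have dist': "distinct [x, a, b, e]" using e ab abV by auto
        from z(1) show ?thesis
        proof
          assume "z = d"
          then show ?thesis
            by (intro poly_AT_square[OF G dist dist' ab(1) na nb P]) (use z a low_b abV in auto)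
        next
          assume "z = e"
          \<comment> \<open>\<open>poly_AT_square\<close> charges the outer neighbour of its first
            triangle vertex, so the triangle is read with \<open>b\<close> first.\<close>
          have swap: "distinct [x, b, a, e]" "distinct [x, b, a, d]" "nb E x = {b, a}"
            using dist dist' ab(1) by auto
          have "poly_AT (V - {x, b, a}) (del E {x, b, a}) (\<lambda>v. if v = z then 2 else if v = y then t else 3)"
            using P by (simp add: insert_commute)
          then show ?thesis
            by (intro poly_AT_square[OF G swap nb na]) (use \<open>z = e\<close> z a low_b abV in auto)
        qed
      qed
    qed
  qed
qed

theorem mainTheorem1:
  fixes V :: "'a set" and E :: "'a set set" and x y :: 'a
  assumes "simple_graph V E"
    and "\<not> has_K4_minor V E"
    and "x \<in> V" and "y \<in> V" and "x \<noteq> y"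
  shows "AT_extendable2 V E 2 2 x y \<and>
         (\<not> connected_by_chain_of_diamonds V E {x, y} \<longrightarrow> AT_extendable2 V E 2 1 x y)"
proof -
  have "AT_extendable2 V E 2 t x y" if "t = 2 \<or> t = 1 \<and> (x, y) \<notin> (dia E)\<^sup>*" for t
    unfolding AT_extendable2_def
    using f_AT_if_poly_AT[OF assms(1) poly_AT_two_roots[OF assms that]] .
  then show ?thesis using chain_if_dia_rtrancl[OF assms(1) _ assms(3)] by blast
qed

end
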